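(* Let $a,b,p,q$ be complex numbers with $p\neq0$, $q\neq0$, $p^2-4q\neq0$, and let $(w_n)$, $(v_n)$, $\alpha,\beta,A,B$ be as in the context. Let $r,s,k$ be integers, $n$ a nonnegative integer, and $z$ a complex number such that $D_i:=q^{rn} z^2 - q^{ri} v_{r(n - 2i)}z + 1\neq0$ for all $i\in\{0,\dots,n\}$. Then \[ \begin{split} &2\sum_{j = 0}^k w_{rj+s}^n z^j \\ &=z^{k + 2}\sum_{i = 0}^n (AB)^iq^{si}\binom ni\frac{A^{n - 2i} \alpha^{s(n - 2i) + rn(k + 1) - rik} \beta^{r(ik + n)} + B^{n - 2i} \alpha^{r(ik + n)} \beta^{s(n - 2i) + rn(k + 1) - rik} }{D_i} \\ &\quad-z^{k + 1}\sum_{i = 0}^n (AB)^iq^{si}\binom ni\frac{A^{n - 2i} \alpha^{s(n - 2i) + (rn - ri)(k + 1)} \beta^{ri(k + 1)} + B^{n - 2i} \alpha^{ri(k + 1)} \beta^{s(n - 2i) + (rn - ri)(k + 1)} }{D_i} \\ &\quad-z\sum_{i = 0}^n (AB)^iq^{si}\binom ni\frac{A^{n - 2i} \alpha^{s(n - 2i) + ri} \beta^{r(n - i)} + B^{n - 2i} \alpha^{r(n - i)} \beta^{s(n - 2i) + ri} }{D_i} \\ &\quad+\sum_{i = 0}^n (AB)^iq^{si}\binom ni\frac{A^{n - 2i} \alpha^{s(n - 2i)} + B^{n - 2i} \beta^{s(n - 2i)} }{D_i}\,, \end{split} \] where $(AB)^iA^{n-2i}$ and $(AB)^iB^{n-2i}$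 are understood as $A^{n-i}B^i$ and $A^iB^{n-i}$ respectively.
   Context: The Horadam sequence $(w_n)=(w_n(a,b;p,q))$ is defined by $w_0=a$, $w_1=b$, $w_n=pw_{n-1}-qw_{n-2}$, extended to all integers by running the recurrence backwards; $(v_n)=(w_n(2,p;p,q))$ is the Lucas sequence of the second kind. Let $\alpha=(p+\sqrt{p^2-4q})/2$, $\beta=(p-\sqrt{p^2-4q})/2$ (so $\alpha+\beta=p$, $\alpha\beta=q$, $v_n=\alpha^n+\beta^n$), and $A=(b-a\beta)/(\alpha-\beta)$, $B=(a\alpha-b)/(\alpha-\beta)$, so that $w_n=A\alpha^n+B\beta^n$ for all integers $n$. *)

theory Defs
  imports Complex_Main
begin

text \<open>The sequence over all integers; for negative indices the recurrence
  \<open>w m = p * w (m - 1) - q * w (m - 2)\<close> is solved for its last term,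
  which is meaningful for \<open>q \<noteq> 0\<close>.\<close>

function horadam :: "complex \<Rightarrow> complex \<Rightarrow> complex \<Rightarrow> complex \<Rightarrow> int \<Rightarrow> complex" where
  "horadam a b p q m =
     (if m = 0 then a
      else if m = 1 then b
      else if m \<ge> 2 then p * horadam a b p q (m - 1) - q * horadam a b p q (m - 2)
      else (p * horadam a b p q (m + 1) - horadam a b p q (m + 2)) / q)"
  by pat_completeness auto
termination
  by (relation "measure (\<lambda>(a, b, p, q, m). nat (if m \<ge> 0 then m else 2 - m))") auto

declare horadam.simps [simp del]

lemma horadam_0: "horadam a b p q 0 = a"
  and horadam_1: "horadam a b p q 1 = b"
  by (simp_all add: horadam.simps)

lemma horadam_rec:
  assumes "q \<noteq> 0"
  shows "horadam a b p q m = p * horadam a b p q (m - 1) - q * horadam a b p q (m - 2)"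
proof (cases "m \<ge> 2")
  case True
  then show ?thesis by (subst horadam.simps) auto
next
  case False
  then have "horadam a b p q (m - 2) = (p * horadam a b p q (m - 1) - horadam a b p q m) / q"
    by (subst horadam.simps) auto
  then show ?thesis using assms by simp
qed

text \<open>The sum of \<open>f j\<close> from \<open>j = 0\<close> to an arbitrary integer \<open>k\<close>, with the usual extension
  to negative upper limits: it vanishes for \<open>k = -1\<close>, and for \<open>k < -1\<close> it is minus the sum
  from \<open>k + 1\<close> to \<open>-1\<close>. For every \<open>k\<close> at least one of the two sums below is empty.\<close>

definition sum_from_0 :: "(int \<Rightarrow> complex) \<Rightarrow> int \<Rightarrow> complex" where
  "sum_from_0 f k = (\<Sum>j\<in>{0..k}. f j) - (\<Sum>j\<in>{k + 1..-1}. f j)"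

lemma sum_from_0_nonneg: "k \<ge> 0 \<Longrightarrow> sum_from_0 f k = (\<Sum>j = 0..k. f j)"
  by (simp add: sum_from_0_def)

lemma sum_from_0_step: "sum_from_0 f k = sum_from_0 f (k - 1) + f k"
proof (cases "k \<ge> 0")
  case True
  then have "{0..k} = insert k {0..k - 1}" by auto
  then show ?thesis using True by (simp add: sum_from_0_def)
next
  case False
  then have "{k..-1} = insert k {k + 1..-1}" by auto
  then show ?thesis using False by (simp add: sum_from_0_def)
qed

end

theory Submission
  imports Defs
begin

text \<open>By the Binet formula and the binomial theorem, \<open>w (r j + s) ^ n\<close> is a linear
  combination of the geometric sequences in \<open>j\<close> with ratios
  \<open>x i = \<alpha>^(r (n - i)) \<beta>^(r i)\<close>. Reversing the binomial sum gives the same expansion with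
  ratios \<open>y i = \<alpha>^(r i) \<beta>^(r (n - i))\<close>; adding the two accounts for the factor 2. Since
  \<open>D i = (1 - x i z) (1 - y i z)\<close>, the two geometric sums over \<open>j\<close> have the common
  denominator \<open>D i\<close>.\<close>

text \<open>Both sides satisfy the same second-order recurrence, since \<open>x\<close> and
  \<open>y\<close> are roots of its characteristic polynomial, and they agree at 0 and 1. Two-sided
  induction on pairs of neighbouring values then covers all integers. Arbitrary \<open>A\<close> and
  \<open>B\<close> let it serve both \<open>w\<close> and \<open>v\<close>.\<close>

lemma horadam_binet:
  assumes q: "q \<noteq> 0" and x: "x\<^sup>2 = p * x - q" and y: "y\<^sup>2 = p * y - q"
    and a: "a = A + B" and b: "b = A * x + B * y"
  shows "horadam a b p q m = A * x powi m + B * y powi m"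
proof -
  have nz: "x \<noteq> 0" "y \<noteq> 0"
    using q x y by auto
  have rec: "t powi (m + 1) = p * t powi m - q * t powi (m - 1)"
    if "t \<noteq> 0" "t\<^sup>2 = p * t - q" for t :: complex and m
  proof -
    have "t powi (m + 1) = t powi (m - 1) * t\<^sup>2" "t powi m = t powi (m - 1) * t"
      using that(1) power_int_add[of t "m - 1" 2] power_int_add[of t "m - 1" 1]
      by (simp_all add: add.commute)
    then show ?thesis
      by (simp add: that(2) algebra_simps)
  qed
  have hrec: "horadam a b p q (m + 1) = p * horadam a b p q m - q * horadam a b p q (m - 1)" for m
    using horadam_rec[OF q, of a b p "m + 1"] by simp
  let ?g = "\<lambda>m. A * x powi m + B * y powi m"
  have grec: "?g (m + 1) = p * ?g m - q * ?g (m - 1)" for m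
    unfolding rec[OF nz(1) x] rec[OF nz(2) y] by (simp add: algebra_simps)
  have "horadam a b p q m = ?g m \<and> horadam a b p q (m + 1) = ?g (m + 1)"
  proof (induction m rule: int_induct[where k = 0])
    case base
    show ?case by (simp add: horadam_0 horadam_1 a b)
  next
    case (step1 i)
    then show ?case
      using hrec[of "i + 1"] grec[of "i + 1"] by simp
  next
    case (step2 i)
    \<comment> \<open>Downwards, the recurrence is solved for its last term, multiplied by
      \<open>q\<close>; this factor is cancelled at the end.\<close>
    have "q * horadam a b p q (i - 1) = p * horadam a b p q i - horadam a b p q (i + 1)"
      using hrec[of i] by simp
    also have "\<dots> = p * ?g i - ?g (i + 1)"
      using step2.IH by simp
    also have "\<dots> = q * ?g (i - 1)"
      unfolding grec[of i] by simp
    finally show ?case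
      using step2.IH q by simp
  qed
  then show ?thesis ..
qed

lemma sum_from_0_sum:
  "sum_from_0 (\<lambda>j. \<Sum>i\<in>I. f i j) k = (\<Sum>i\<in>I. sum_from_0 (f i) k)"
  unfolding sum_from_0_def by (simp add: sum_subtractf sum.swap[of _ I])

lemma sum_from_0_cmult: "sum_from_0 (\<lambda>j. c * f j) k = c * sum_from_0 f k"
  unfolding sum_from_0_def by (simp add: sum_distrib_left algebra_simps)

text \<open>Telescoping. The undivided form includes \<open>u = 1\<close>. Induction runs both ways
  from -1, where both sides are 0.\<close>

lemma sum_from_0_geometric:
  assumes "k \<ge> -1 \<or> u \<noteq> 0"
  shows "(1 - u) * sum_from_0 (\<lambda>j. u powi j) k = 1 - u powi (k + 1)"
  using assms
proof (induction k rule: int_induct[where k = "-1"])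
  case base
  show ?case by (simp add: sum_from_0_def)
next
  case (step1 i)
  \<comment> \<open>This also holds for \<open>u = 0\<close>, as the exponent on the left is at
    least 1.\<close>
  have "u powi (i + 1 + 1) = u powi (i + 1) * u"
    using step1.hyps power_int_add[of u "i + 1" 1] by (cases "u = 0") auto
  then have "(1 - u) * u powi (i + 1) = u powi (i + 1) - u powi (i + 1 + 1)"
    by (simp add: algebra_simps)
  then show ?case
    using step1.IH step1.prems sum_from_0_step[of "\<lambda>j. u powi j" "i + 1"] step1.hyps
    by (simp add: distrib_left)
next
  case (step2 i)
  then have "u \<noteq> 0" by auto
  then have "u powi (i + 1) = u powi i * u"
    using power_int_add[of u i 1] by auto
  then show ?case
    using step2 \<open>u \<noteq> 0\<close> sum_from_0_step[of "\<lambda>j. u powi j" i] by (simp add: algebra_simps)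
qed

text \<open>After multiplication by \<open>D\<close>, one factor of \<open>D\<close> closes each
  geometric sum and the other remains as a cofactor. Expanding the cofactors gives the four powers
  of \<open>z\<close> that structure the final formula.\<close>

lemma sum_from_0_geometric_pair:
  assumes k: "k \<ge> -1 \<or> z \<noteq> 0" and nz: "x \<noteq> 0" "y \<noteq> 0"
    and D: "D = (1 - x * z) * (1 - y * z)" "D \<noteq> 0"
  shows "c * sum_from_0 (\<lambda>j. (x * z) powi j) k + d * sum_from_0 (\<lambda>j. (y * z) powi j) k =
      z powi (k + 2) * ((c * x powi (k + 1) * y + d * x * y powi (k + 1)) / D)
    - z powi (k + 1) * ((c * x powi (k + 1) + d * y powi (k + 1)) / D)
    - z * ((c * y + d * x) / D) + (c + d) / D"
proof -
  define S T where "S = sum_from_0 (\<lambda>j. (x * z) powi j) k"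
    and "T = sum_from_0 (\<lambda>j. (y * z) powi j) k"
  have S: "(1 - x * z) * S = 1 - x powi (k + 1) * z powi (k + 1)"
    and T: "(1 - y * z) * T = 1 - y powi (k + 1) * z powi (k + 1)"
    unfolding S_def T_def power_int_mult_distrib[symmetric]
    using k nz by (auto intro!: sum_from_0_geometric)
  have z: "z powi (k + 2) = z powi (k + 1) * z"
    using k power_int_add[of z "k + 1" 1] by (cases "z = 0") (auto simp: add.commute)
  have "(c * S + d * T) * D = c * (1 - y * z) * ((1 - x * z) * S) + d * (1 - x * z) * ((1 - y * z) * T)"
    unfolding D(1) by (simp add: algebra_simps)
  also have "\<dots> = z powi (k + 2) * (c * x powi (k + 1) * y + d * x * y powi (k + 1))
      - z powi (k + 1) * (c * x powi (k + 1) + d * y powi (k + 1)) - z * (c * y + d * x) + (c + d)"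
    unfolding S T z by (simp add: algebra_simps)
  finally show ?thesis
    using D(2) unfolding S_def[symmetric] T_def[symmetric]
    by (simp add: eq_divide_eq add_divide_distrib[symmetric] diff_divide_distrib[symmetric])
qed

theorem theorem3:
  fixes a b p q z \<alpha> \<beta> A B :: complex
    and w v :: "int \<Rightarrow> complex"
    and D :: "nat \<Rightarrow> complex"
    and r s k :: int
    and n :: nat
  assumes "p \<noteq> 0" and "q \<noteq> 0" and "p\<^sup>2 - 4 * q \<noteq> 0"
    and "w = horadam a b p q"
    and "v = horadam 2 p p q"
    and "\<alpha> = (p + csqrt (p\<^sup>2 - 4 * q)) / 2"
    and "\<beta> = (p - csqrt (p\<^sup>2 - 4 * q)) / 2"
    and "A = (b - a * \<beta>) / (\<alpha> - \<beta>)"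
    and "B = (a * \<alpha> - b) / (\<alpha> - \<beta>)"
    and "\<And>i. D i = q powi (r * int n) * z\<^sup>2
               - q powi (r * int i) * v (r * (int n - 2 * int i)) * z + 1"
    and "\<And>i. i \<in> {0..n} \<Longrightarrow> D i \<noteq> 0"
    \<comment> \<open>Only excludes negative powers of 0: for \<open>k \<ge> -1\<close> no exponent of \<open>z\<close> is negative.\<close>
    and "k \<ge> -1 \<or> z \<noteq> 0"
  shows "2 * sum_from_0 (\<lambda>j. w (r * j + s) ^ n * z powi j) k =
      z powi (k + 2) * (\<Sum>i = 0..n. q powi (s * int i) * of_nat (n choose i) *
        (A ^ (n - i) * B ^ i
           * \<alpha> powi (s * (int n - 2 * int i) + r * int n * (k + 1) - r * int i * k)
           * \<beta> powi (r * (int i * k + int n))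
         + A ^ i * B ^ (n - i)
           * \<alpha> powi (r * (int i * k + int n))
           * \<beta> powi (s * (int n - 2 * int i) + r * int n * (k + 1) - r * int i * k)) / D i)
    - z powi (k + 1) * (\<Sum>i = 0..n. q powi (s * int i) * of_nat (n choose i) *
        (A ^ (n - i) * B ^ i
           * \<alpha> powi (s * (int n - 2 * int i) + (r * int n - r * int i) * (k + 1))
           * \<beta> powi (r * int i * (k + 1))
         + A ^ i * B ^ (n - i)
           * \<alpha> powi (r * int i * (k + 1))
           * \<beta> powi (s * (int n - 2 * int i) + (r * int n - r * int i) * (k + 1))) / D i)
    - z * (\<Sum>i = 0..n. q powi (s * int i) * of_nat (n choose i) *
        (A ^ (n - i) * B ^ i
           * \<alpha> powi (s * (int n - 2 * int i) + r * int i)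
           * \<beta> powi (r * (int n - int i))
         + A ^ i * B ^ (n - i)
           * \<alpha> powi (r * (int n - int i))
           * \<beta> powi (s * (int n - 2 * int i) + r * int i)) / D i)
    + (\<Sum>i = 0..n. q powi (s * int i) * of_nat (n choose i) *
        (A ^ (n - i) * B ^ i * \<alpha> powi (s * (int n - 2 * int i))
         + A ^ i * B ^ (n - i) * \<beta> powi (s * (int n - 2 * int i))) / D i)"
proof -
  note q = \<open>q \<noteq> 0\<close>
  define e where "e = csqrt (p\<^sup>2 - 4 * q)"
  have e2: "e\<^sup>2 = p\<^sup>2 - 4 * q"
    by (simp add: e_def)
  then have e: "e \<noteq> 0"
    using assms(3) by auto
  have \<alpha>: "\<alpha> = (p + e) / 2" and \<beta>: "\<beta> = (p - e) / 2"
    using assms(6,7) by (simp_all add: e_def)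
  have add: "\<alpha> + \<beta> = p" and diff: "\<alpha> - \<beta> \<noteq> 0"
    using e by (simp_all add: \<alpha> \<beta> field_simps)
  have "4 * (\<alpha> * \<beta>) = p\<^sup>2 - e\<^sup>2"
    by (simp add: \<alpha> \<beta> field_simps power2_eq_square)
  then have mult: "\<alpha> * \<beta> = q"
    by (simp add: e2)
  have roots: "\<alpha>\<^sup>2 = p * \<alpha> - q" "\<beta>\<^sup>2 = p * \<beta> - q"
    unfolding add[symmetric] mult[symmetric] by (simp_all add: algebra_simps power2_eq_square)
  have nz: "\<alpha> \<noteq> 0" "\<beta> \<noteq> 0"
    using mult q by auto
  have "(A + B) * (\<alpha> - \<beta>) = a * (\<alpha> - \<beta>)" "(A * \<alpha> + B * \<beta>) * (\<alpha> - \<beta>) = b * (\<alpha> - \<beta>)"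
    using diff unfolding assms(8,9) by (simp_all add: divide_simps) (simp_all add: algebra_simps)
  then have "a = A + B" "b = A * \<alpha> + B * \<beta>"
    using diff by simp_all
  then have w: "w m = A * \<alpha> powi m + B * \<beta> powi m" for m
    using horadam_binet[OF q roots] unfolding assms(4) by blast
  \<comment> \<open>The case \<open>A = B = 1\<close>: the initial values are 2 = 1 + 1 and p =
    \<alpha> + \<beta>.\<close>
  have v: "v m = \<alpha> powi m + \<beta> powi m" for m
    using horadam_binet[OF q roots, of 2 1 1 p m] add unfolding assms(5) by simp

  \<comment> \<open>Writing every power of \<alpha>, \<beta> and \<open>q\<close> as such a monomial
    reduces the identities below to integer arithmetic on exponents.\<close>
  define P where "P l m = \<alpha> powi l * \<beta> powi m" for l m
  have P_mult: "P l m * P l' m' = P (l + l') (m + m')" for l m l' m'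
    using nz by (simp add: P_def power_int_add)
  have P_powi: "P l m powi j = P (l * j) (m * j)" for l m j
    by (simp add: P_def power_int_mult_distrib power_int_mult)
  have P_q: "q powi m = P m m" for m
    by (simp add: P_def mult[symmetric] power_int_mult_distrib)
  have P_nz: "P l m \<noteq> 0" for l m
    using nz by (simp add: P_def)
  have P_\<alpha>: "\<alpha> powi m = P m 0" and P_\<beta>: "\<beta> powi m = P 0 m" for m
    by (simp_all add: P_def)

  define x y where "x i = P (r * (int n - int i)) (r * int i)"
    and "y i = P (r * int i) (r * (int n - int i))" for i
  \<comment> \<open>\<open>d i\<close> is the factor independent of \<open>j\<close> in the
    \<open>i\<close>-th binomial term, and \<open>c i\<close> is its mirror image under i -> n -
    i.\<close>
  define c d where
    "c i = of_nat (n choose i) * A ^ (n - i) * B ^ i * P (s * (int n - int i)) (s * int i)"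
    and "d i = of_nat (n choose i) * A ^ i * B ^ (n - i) * P (s * int i) (s * (int n - int i))" for i
  \<comment> \<open>Compare coefficients in \<open>z\<close>: the product of the ratios is q^(rn),
    and their sum is q^(ri) v_(r(n - 2i)) after taking out the common factor
    (\<alpha>\<beta>)^(ri).\<close>
  have D: "D i = (1 - x i * z) * (1 - y i * z)" for i
  proof -
    have "x i * y i = q powi (r * int n)"
      unfolding x_def y_def P_q P_mult by (simp add: algebra_simps)
    moreover have "x i + y i = q powi (r * int i) * v (r * (int n - 2 * int i))"
      unfolding x_def y_def v P_q P_\<alpha> P_\<beta> distrib_left P_mult by (simp add: algebra_simps)
    moreover have "(1 - x i * z) * (1 - y i * z) = x i * y i * z\<^sup>2 - (x i + y i) * z + 1"
      by (simp add: algebra_simps power2_eq_square)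
    ultimately show ?thesis
      using assms(10) by simp
  qed
  have expand: "w (r * j + s) ^ n * z powi j = (\<Sum>i = 0..n. d i * (y i * z) powi j)" for j
  proof -
    have "w (r * j + s) ^ n * z powi j =
        (\<Sum>i\<le>n. of_nat (n choose i) * (A * \<alpha> powi (r * j + s)) ^ i
          * (B * \<beta> powi (r * j + s)) ^ (n - i)) * z powi j"
      unfolding w binomial_ring ..
    also have "\<dots> = (\<Sum>i\<le>n. d i * (y i * z) powi j)"
      unfolding sum_distrib_right
    proof (rule sum.cong)
      fix i assume "i \<in> {..n}"
      then have i: "int (n - i) = int n - int i" by auto
      have "(\<alpha> powi (r * j + s)) ^ i * (\<beta> powi (r * j + s)) ^ (n - i)
          = P ((r * j + s) * int i) ((r * j + s) * (int n - int i))"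
        by (simp add: P_def power_int_mult i[symmetric])
      also have "\<dots> = P (s * int i) (s * (int n - int i)) * y i powi j"
        unfolding y_def P_powi P_mult by (simp add: algebra_simps)
      finally show "of_nat (n choose i) * (A * \<alpha> powi (r * j + s)) ^ i
          * (B * \<beta> powi (r * j + s)) ^ (n - i) * z powi j = d i * (y i * z) powi j"
        by (simp add: d_def power_mult_distrib power_int_mult_distrib mult_ac)
    qed simp
    finally show ?thesis
      by (simp add: atMost_atLeast0)
  qed
  have flip: "c i = d (n - i)" "x i = y (n - i)" if "i \<in> {0..n}" for i
    using that by (auto simp: c_def d_def x_def y_def of_nat_diff binomial_symmetric[symmetric])
  have expand': "w (r * j + s) ^ n * z powi j = (\<Sum>i = 0..n. c i * (x i * z) powi j)" for j
    unfolding expand by (subst sum.atLeastAtMost_rev) (simp add: flip)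

  let ?S = "\<lambda>u. sum_from_0 (\<lambda>j. (u * z) powi j) k"
  \<comment> \<open>One copy of the sum is expanded by \<open>expand'\<close>, the other by
    \<open>expand\<close>, so that index \<open>i\<close> collects both ratios belonging to
    \<open>D i\<close>.\<close>
  have "2 * sum_from_0 (\<lambda>j. w (r * j + s) ^ n * z powi j) k
      = (\<Sum>i = 0..n. c i * ?S (x i)) + (\<Sum>i = 0..n. d i * ?S (y i))"
    unfolding mult_2 by (subst expand', subst expand) (simp only: sum_from_0_sum sum_from_0_cmult)
  also have "\<dots> = (\<Sum>i = 0..n. c i * ?S (x i) + d i * ?S (y i))"
    by (simp add: sum.distrib)
  also have "\<dots> = (\<Sum>i = 0..n.
      z powi (k + 2) * ((c i * x i powi (k + 1) * y i + d i * x i * y i powi (k + 1)) / D i)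
    - z powi (k + 1) * ((c i * x i powi (k + 1) + d i * y i powi (k + 1)) / D i)
    - z * ((c i * y i + d i * x i) / D i) + (c i + d i) / D i)"
    using assms(11,12) P_nz D
    by (intro sum.cong sum_from_0_geometric_pair) (simp_all add: x_def y_def)
  also have "\<dots> =
      z powi (k + 2) * (\<Sum>i = 0..n. (c i * x i powi (k + 1) * y i + d i * x i * y i powi (k + 1)) / D i)
    - z powi (k + 1) * (\<Sum>i = 0..n. (c i * x i powi (k + 1) + d i * y i powi (k + 1)) / D i)
    - z * (\<Sum>i = 0..n. (c i * y i + d i * x i) / D i) + (\<Sum>i = 0..n. (c i + d i) / D i)"
    by (simp only: sum.distrib sum_subtractf sum_distrib_left)
  finally have sum: "2 * sum_from_0 (\<lambda>j. w (r * j + s) ^ n * z powi j) k = \<dots>" .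

  \<comment> \<open>The common shape of the four numerators. The factor q^(si) raises both exponents
    by si, turning (s(n - 2i), 0) into the pair (s(n - i), si) carried by
    \<open>c i\<close>.\<close>
  have coeff: "q powi (s * int i) * of_nat (n choose i) *
      (A ^ (n - i) * B ^ i * \<alpha> powi l * \<beta> powi m + A ^ i * B ^ (n - i) * \<alpha> powi m * \<beta> powi l)
    = of_nat (n choose i) * A ^ (n - i) * B ^ i * P (s * int i + l) (s * int i + m)
      + of_nat (n choose i) * A ^ i * B ^ (n - i) * P (s * int i + m) (s * int i + l)" for i l m
    unfolding P_q P_mult[symmetric] by (simp add: P_def algebra_simps)
  note unfold_P = c_def d_def x_def y_def P_powi mult.assoc P_mult
  \<comment> \<open>The exponents agree because r(n - i)(k + 1) + ri = rn(k + 1) - rik and ri(k + 1)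
    + r(n - i) = r(ik + n).\<close>
  have "c i * x i powi (k + 1) * y i + d i * x i * y i powi (k + 1)
      = q powi (s * int i) * of_nat (n choose i) *
        (A ^ (n - i) * B ^ i
           * \<alpha> powi (s * (int n - 2 * int i) + r * int n * (k + 1) - r * int i * k)
           * \<beta> powi (r * (int i * k + int n))
         + A ^ i * B ^ (n - i)
           * \<alpha> powi (r * (int i * k + int n))
           * \<beta> powi (s * (int n - 2 * int i) + r * int n * (k + 1) - r * int i * k))" for i
    unfolding coeff unfolding unfold_P by (simp add: algebra_simps)
  moreover have "c i * x i powi (k + 1) + d i * y i powi (k + 1)
      = q powi (s * int i) * of_nat (n choose i) *
        (A ^ (n - i) * B ^ i
           * \<alpha> powi (s * (int n - 2 * int i) + (r * int n - r * int i) * (k + 1))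
           * \<beta> powi (r * int i * (k + 1))
         + A ^ i * B ^ (n - i)
           * \<alpha> powi (r * int i * (k + 1))
           * \<beta> powi (s * (int n - 2 * int i) + (r * int n - r * int i) * (k + 1)))" for i
    unfolding coeff unfolding unfold_P by (simp add: algebra_simps)
  moreover have "c i * y i + d i * x i
      = q powi (s * int i) * of_nat (n choose i) *
        (A ^ (n - i) * B ^ i
           * \<alpha> powi (s * (int n - 2 * int i) + r * int i)
           * \<beta> powi (r * (int n - int i))
         + A ^ i * B ^ (n - i)
           * \<alpha> powi (r * (int n - int i))
           * \<beta> powi (s * (int n - 2 * int i) + r * int i))" for i
    unfolding coeff unfolding unfold_P by (simp add: algebra_simps)
  moreover have "c i + d i
      = q powi (s * int i) * of_nat (n choose i) *
        (A ^ (n - i) * B ^ i * \<alpha> powi (s * (int n - 2 * int i))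
         + A ^ i * B ^ (n - i) * \<beta> powi (s * (int n - 2 * int i)))" for i
    using coeff[of i "s * (int n - 2 * int i)" 0] by (simp add: c_def d_def algebra_simps)
  ultimately show ?thesis
    unfolding sum by simp
qed

end
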